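(* Let $n$ be the number of picking stops, and let these be divided into $m$ pairwise disjoint clusters, containing $n_1,\ldots,n_m$ picking stops respectively, where $n_1+\ldots+n_m=n$. If an undirected non-closed route has been determined for each cluster, then the total number of possible global undirected routes connecting them is $$m!\times 2^{m-1}.$$ The total cost of also finding optimal routes in each individual cluster is therefore $$m!\times 2^{m-1}+\frac12\left(n_1!+\ldots+n_m!\right).$$
   Context: Picking stops are the locations in the horizontal plane of a warehouse at which articles of a given order are to be picked. A route through a set of picking stops is an ordering of the stops in the set. The entrance and exit of the warehouse are assumed to coincide and are not part of the route, so routes are not closed curves. Two routes are treated as identical if they differ only in their travel direction; routes under this identification are called undirected. The number of possible undirected non-closed routes between $k$ picking stops is counted as $\frac12 k!$. The boundary nodes of a cluster's route are its end stops. Given an undirected route for each cluster, a global route connecting them goes through all the clusters one after another, in some order, along these routes: for each cluster visited one chooses which boundary node of its route to start from, follows the cluster's route to its other end, and then continues to a chosen starting boundary node of the next cluster. A global undirected route is such a global route with the two travel directions identified. Cost is measured by brute-force enumeration, without algorithms that reduce complexity: the cost of finding an optimal route is the number of possible undirected routes to choose from. The total cost is the number of global undirected routes connecting the clusters' routes plus, for each cluster, the number of undirected non-closed routes between its picking stops. *)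

theory Defs
  imports Complex_Main "HOL-Library.Disjoint_Sets" "HOL-Combinatorics.Multiset_Permutations"
begin

text \<open>
  A (directed) route through a finite set \<open>A\<close> of picking stops is an element of
  \<open>permutations_of_set A\<close>, i.e. a list visiting every stop exactly once. Since entrance and
  exit are not part of the route, cyclic shifts are not identified.
\<close>

definition undirected :: "'a list \<Rightarrow> 'a list set" where
  "undirected xs = {xs, rev xs}"

definition undirected_routes :: "'a set \<Rightarrow> 'a list set set" where
  "undirected_routes A = undirected ` permutations_of_set A"

text \<open>
  The brute-force cost is the number of undirected routes. For a single stop there is one route,
  equal to its own reversal, but the convention that \<open>k\<close> stops count as \<open>k! / 2\<close>
  prescribes the value 1/2; only that degenerate case is fixed by convention here.
\<close>

definition cluster_cost :: "'a set \<Rightarrow> real" where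
  "cluster_cost A =
     (if card A \<ge> 2 then real (card (undirected_routes A)) else fact (card A) / 2)"

text \<open>
  The undirected route of a cluster is given by either one of its two orderings \<open>xs\<close>. A leg
  through the cluster records the end at which it starts (\<open>True\<close>: the end \<open>hd xs\<close>,
  \<open>False\<close>: the end \<open>last xs\<close>) and the stops in the order in which they are visited.
  The first component matters only if the cluster is a single stop: its route still has two
  ends, which are occupied by the same stop and are counted as two choices.
\<close>

type_synonym 'a leg = "bool \<times> 'a list"

definition legs :: "'a list \<Rightarrow> 'a leg set" where
  "legs xs = {(True, xs), (False, rev xs)}"

definition reverse_leg :: "'a leg \<Rightarrow> 'a leg" where
  "reverse_leg l = (\<not> fst l, rev (snd l))"

text \<open>
  In the following, \<open>r i\<close> is the route of cluster \<open>i < m\<close>, and the list \<open>p\<close> is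
  the order in which the clusters are visited.
\<close>

definition global_routes :: "(nat \<Rightarrow> 'a list) \<Rightarrow> nat \<Rightarrow> 'a leg list set" where
  "global_routes r m =
     {g. \<exists>p \<in> permutations_of_set {..<m}. list_all2 (\<lambda>i l. l \<in> legs (r i)) p g}"

definition reverse_global :: "'a leg list \<Rightarrow> 'a leg list" where
  "reverse_global g = rev (map reverse_leg g)"

definition global_undirected_routes :: "(nat \<Rightarrow> 'a list) \<Rightarrow> nat \<Rightarrow> 'a leg list set set" where
  "global_undirected_routes r m = (\<lambda>g. {g, reverse_global g}) ` global_routes r m"

definition stop_sequence :: "'a leg list \<Rightarrow> 'a list" where
  "stop_sequence g = concat (map snd g)"

definition total_cost :: "(nat \<Rightarrow> 'a set) \<Rightarrow> (nat \<Rightarrow> 'a list) \<Rightarrow> nat \<Rightarrow> real" where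
  "total_cost C r m =
     real (card (global_undirected_routes r m)) + (\<Sum>i<m. cluster_cost (C i))"

end

theory Submission
  imports Defs
begin

text \<open>
  Reversal is an involution on directed routes, so if no route is its own reversal then there are
  half as many undirected routes as directed ones. This holds at all three levels considered:

  \<^item> Orderings of a cluster: a repetition-free list with at least two entries is never a
    palindrome, so there are \<open>k! / 2\<close> undirected routes through \<open>k \<ge> 2\<close> stops.
    For fewer stops the cost is \<open>k! / 2\<close> by convention.

  \<^item> Global routes as lists of legs: clusters are disjoint and nonempty, hence a leg reveals its
    cluster, and a global route is the same thing as an order \<open>p\<close> of the clusters together with
    one bit per position. This gives \<open>m! * 2 ^ m\<close> directed routes. A global route that equals its
    reversal would have \<open>p\<close> a palindrome, so a single cluster; but the end at which the only leg
    starts is flipped by reversal.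

  \<^item> Global routes as sequences of stops, when every cluster has at least two stops: the leg
    structure can be read off the sequence (\<open>stop_sequence_inj\<close>), so the directed count does
    not change, and again a repetition-free sequence is no palindrome.
\<close>

section \<open>Counting up to a fixed-point-free involution\<close>

lemma card_involution_orbits:
  assumes "finite X"
    and closed: "\<And>x. x \<in> X \<Longrightarrow> f x \<in> X"
    and invol: "\<And>x. x \<in> X \<Longrightarrow> f (f x) = x"
    and no_fix: "\<And>x. x \<in> X \<Longrightarrow> f x \<noteq> x"
  shows "2 * card ((\<lambda>x. {x, f x}) ` X) = card X"
proof -
  let ?O = "(\<lambda>x. {x, f x}) ` X"
  have "2 * card ?O = card (\<Union>?O)"
  proof (rule card_partition)
    show "finite ?O" "finite (\<Union>?O)"
      using assms(1) by auto
    show "card c = 2" if "c \<in> ?O" for c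
      using that no_fix by (fastforce simp: card_2_iff)
    show "c \<inter> d = {}" if "c \<in> ?O" "d \<in> ?O" "c \<noteq> d" for c d
    proof -
      have orbit: "e = {z, f z}" if "e \<in> ?O" "z \<in> e" for e z
      proof -
        obtain x where x: "x \<in> X" "e = {x, f x}"
          using \<open>e \<in> ?O\<close> by blast
        with \<open>z \<in> e\<close> consider "z = x" | "z = f x"
          by blast
        then show ?thesis
        proof cases
          case 2
          with x invol[OF x(1)] show ?thesis
            by (simp add: insert_commute)
        qed (simp add: x)
      qed
      have "z \<notin> d" if "z \<in> c" for z
        using orbit[OF \<open>c \<in> ?O\<close> that] orbit[OF \<open>d \<in> ?O\<close>, of z] \<open>c \<noteq> d\<close> by argo
      then show ?thesis
        by blast
    qed
  qed
  also have "\<Union>?O = X"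
    using closed by auto
  finally show ?thesis .
qed

text \<open>The first and the last entry of a palindrome agree.\<close>

lemma distinct_palindrome_length:
  assumes "distinct xs" "rev xs = xs"
  shows "length xs \<le> 1"
proof (cases xs)
  case (Cons x ys)
  have "last xs = hd xs"
    using assms(2) by (metis last_rev)
  with assms(1) Cons show ?thesis
    by (auto split: if_splits)
qed simp

lemma two_card_undirected:
  assumes "finite X" "rev ` X \<subseteq> X"
    and "\<And>xs. xs \<in> X \<Longrightarrow> distinct xs \<and> length xs \<ge> 2"
  shows "2 * card (undirected ` X) = card X"
proof -
  have "2 * card ((\<lambda>xs. {xs, rev xs}) ` X) = card X"
  proof (rule card_involution_orbits)
    show "rev xs \<noteq> xs" if "xs \<in> X" for xs
      using assms(3)[OF that] distinct_palindrome_length[of xs] by auto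
  qed (use assms in auto)
  then show ?thesis
    by (simp add: undirected_def[abs_def])
qed

lemma cluster_cost_eq:
  assumes "finite A"
  shows "cluster_cost A = fact (card A) / 2"
proof (cases "card A \<ge> 2")
  case True
  have "2 * card (undirected_routes A) = card (permutations_of_set A)"
    unfolding undirected_routes_def
  proof (rule two_card_undirected)
    show "rev ` permutations_of_set A \<subseteq> permutations_of_set A"
      by (auto simp: permutations_of_set_def)
    show "distinct xs \<and> length xs \<ge> 2" if "xs \<in> permutations_of_set A" for xs
      using that True distinct_card[of xs] by (auto simp: permutations_of_set_def)
  qed simp
  then have "real (2 * card (undirected_routes A)) = real (fact (card A))"
    using assms by simp
  with True show ?thesis
    by (simp add: cluster_cost_def)
qed (simp add: cluster_cost_def)

section \<open>Global routes as lists of legs\<close>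

text \<open>
  Disjointness and nonemptiness make a leg reveal which cluster it traverses; distinctness makes the
  stops of a leg reveal its direction once there are two of them.
\<close>

locale disjoint_routes =
  fixes r :: "nat \<Rightarrow> 'a list" and m :: nat
  assumes disj: "\<And>i j. i < m \<Longrightarrow> j < m \<Longrightarrow> i \<noteq> j \<Longrightarrow> set (r i) \<inter> set (r j) = {}"
    and nonempty: "\<And>i. i < m \<Longrightarrow> r i \<noteq> []"
    and dist: "\<And>i. i < m \<Longrightarrow> distinct (r i)"
    and m_pos: "m \<ge> 1"
begin

abbreviation legs_along :: "nat list \<Rightarrow> 'a leg list \<Rightarrow> bool" where
  "legs_along \<equiv> list_all2 (\<lambda>i l. l \<in> legs (r i))"

lemma set_snd_leg: "l \<in> legs (r i) \<Longrightarrow> set (snd l) = set (r i)"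
  by (auto simp: legs_def)

lemma length_snd_leg: "l \<in> legs (r i) \<Longrightarrow> length (snd l) = length (r i)"
  by (auto simp: legs_def)

lemma leg_not_Nil: "l \<in> legs (r i) \<Longrightarrow> i < m \<Longrightarrow> snd l \<noteq> []"
  using nonempty by (auto simp: legs_def)

lemma cluster_eq_if_common_stop:
  assumes "l \<in> legs (r i)" "l' \<in> legs (r j)" "i < m" "j < m" "x \<in> set (snd l)" "x \<in> set (snd l')"
  shows "i = j"
  using assms disj set_snd_leg by blast

lemma order_unique:
  assumes "legs_along p g" "legs_along q g" "set p \<subseteq> {..<m}" "set q \<subseteq> {..<m}"
  shows "p = q"
  using assms
proof (induction g arbitrary: p q rule: list.induct)
  case (Cons l g)
  then obtain i p' j q' where "p = i # p'" "q = j # q'"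
    by (auto simp only: list_all2_Cons2)
  with Cons show ?case
    by (metis cluster_eq_if_common_stop hd_in_set insert_subset leg_not_Nil lessThan_iff
        list.simps(15) list_all2_Cons)
qed simp

lemma global_routesE:
  assumes "g \<in> global_routes r m"
  obtains p where "p \<in> permutations_of_set {..<m}" "legs_along p g"
    "set p = {..<m}" "distinct p" "length p = m"
proof -
  from assms obtain p where p: "p \<in> permutations_of_set {..<m}" "legs_along p g"
    by (auto simp: global_routes_def)
  moreover from p(1) have "set p = {..<m}" "distinct p"
    by (simp_all add: permutations_of_set_def)
  moreover from this have "length p = m"
    using distinct_card[of p] by simp
  ultimately show ?thesis ..
qed

definition route_of :: "nat list \<times> bool list \<Rightarrow> 'a leg list" where
  "route_of = (\<lambda>(p, bs). map2 (\<lambda>i b. (b, if b then r i else rev (r i))) p bs)"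

lemma legs_along_iff:
  "legs_along p g \<longleftrightarrow> (\<exists>bs. length bs = length p \<and> g = route_of (p, bs))"
proof
  assume "legs_along p g"
  then have "g = route_of (p, map fst g)"
    by (induction rule: list_all2_induct) (auto simp: legs_def route_of_def)
  with \<open>legs_along p g\<close> show "\<exists>bs. length bs = length p \<and> g = route_of (p, bs)"
    by (metis length_map list_all2_lengthD)
next
  assume "\<exists>bs. length bs = length p \<and> g = route_of (p, bs)"
  then show "legs_along p g"
    by (auto simp: list_all2_conv_all_nth legs_def route_of_def split: if_splits)
qed

text \<open>
  The cluster order is recovered from the stops and the bits from the first components of the legs,
  so injectivity holds even for a single-stop cluster, whose two legs visit the same stops.
\<close>

lemma bij_betw_route_of:
  "bij_betw route_of (permutations_of_set {..<m} \<times> {bs. length bs = m}) (global_routes r m)"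
proof (rule bij_betw_imageI)
  have len: "length p = m" if "p \<in> permutations_of_set {..<m}" for p
    using that distinct_card[of p] by (simp add: permutations_of_set_def)
  show "route_of ` (permutations_of_set {..<m} \<times> {bs. length bs = m}) = global_routes r m"
    using len by (fastforce simp: global_routes_def legs_along_iff)
  show "inj_on route_of (permutations_of_set {..<m} \<times> {bs. length bs = m})"
  proof (rule inj_onI)
    fix x y
    assume x: "x \<in> permutations_of_set {..<m} \<times> {bs. length bs = m}"
      and y: "y \<in> permutations_of_set {..<m} \<times> {bs. length bs = m}"
      and eq_xy: "route_of x = route_of y"
    obtain p bs q cs where xy: "x = (p, bs)" "y = (q, cs)"
      by (metis prod.exhaust)
    have p: "p \<in> permutations_of_set {..<m}" and q: "q \<in> permutations_of_set {..<m}"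
      and bs: "length bs = m" and cs: "length cs = m" and eq: "route_of (p, bs) = route_of (q, cs)"
      using x y eq_xy by (simp_all add: xy)
    have "legs_along p (route_of (p, bs))" "legs_along q (route_of (p, bs))"
      using len[OF p] len[OF q] bs cs eq unfolding legs_along_iff by metis+
    then have "p = q"
      by (rule order_unique) (use p q in \<open>simp_all add: permutations_of_set_def\<close>)
    have fst_route: "map fst (route_of (s, ds)) = ds" if "length s = length ds" for s ds
      using that by (intro nth_equalityI) (auto simp: route_of_def)
    have "bs = cs"
      using fst_route[of p bs] fst_route[of q cs] len[OF p] len[OF q] bs cs eq by simp
    with \<open>p = q\<close> show "x = y"
      by (simp add: xy)
  qed
qed

lemma finite_global_routes: "finite (global_routes r m)"
  and card_global_routes: "card (global_routes r m) = fact m * 2 ^ m"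
proof -
  have *: "finite {bs :: bool list. length bs = m}" "card {bs :: bool list. length bs = m} = 2 ^ m"
    using finite_lists_length_eq[of "UNIV :: bool set" m]
      card_lists_length_eq[of "UNIV :: bool set" m] by auto
  show "finite (global_routes r m)"
    using bij_betw_finite[OF bij_betw_route_of] *(1) by simp
  show "card (global_routes r m) = fact m * 2 ^ m"
    using bij_betw_same_card[OF bij_betw_route_of] *(2) by (simp add: card_cartesian_product)
qed

lemma legs_along_reverse:
  assumes "legs_along p g"
  shows "legs_along (rev p) (reverse_global g)"
  using assms
  by (auto simp: reverse_global_def list_all2_map2 reverse_leg_def legs_def
      elim!: list_all2_mono)

lemma reverse_global_in:
  assumes "g \<in> global_routes r m"
  shows "reverse_global g \<in> global_routes r m"
proof -
  from assms obtain p where "p \<in> permutations_of_set {..<m}" "legs_along p g"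
    by (rule global_routesE)
  moreover from this have "rev p \<in> permutations_of_set {..<m}"
    by (simp add: permutations_of_set_def)
  ultimately show ?thesis
    unfolding global_routes_def using legs_along_reverse by blast
qed

lemma reverse_global_involution: "reverse_global (reverse_global g) = g"
  by (simp add: reverse_global_def reverse_leg_def rev_map o_def)

lemma reverse_global_no_fix:
  assumes "g \<in> global_routes r m"
  shows "reverse_global g \<noteq> g"
proof
  assume eq: "reverse_global g = g"
  from assms obtain p where p: "legs_along p g" "set p = {..<m}" "distinct p" "length p = m"
    by (rule global_routesE)
  have "rev p = p"
    using legs_along_reverse[OF p(1)] p by (intro order_unique[of _ g]) (simp_all add: eq)
  then have "length g = 1"
    using distinct_palindrome_length[of p] p m_pos list_all2_lengthD[OF p(1)] by linarith
  then obtain l where "g = [l]"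
    by (auto simp: length_Suc_conv)
  with eq have "reverse_leg l = l"
    by (simp add: reverse_global_def)
  then show False
    by (cases l) (auto simp: reverse_leg_def)
qed

text \<open>Here \<open>m \<ge> 1\<close> matters: for \<open>m = 0\<close> the truncated \<open>m - 1\<close> would not halve the count.\<close>

lemma half_directed:
  assumes "2 * N = card (global_routes r m)"
  shows "N = fact m * 2 ^ (m - 1)"
  using assms m_pos unfolding card_global_routes by (cases m) auto

lemma card_global_undirected_routes:
  "card (global_undirected_routes r m) = fact m * 2 ^ (m - 1)"
  unfolding global_undirected_routes_def
  by (intro half_directed card_involution_orbits finite_global_routes reverse_global_in
      reverse_global_involution reverse_global_no_fix)

section \<open>Global routes as sequences of stops\<close>

lemma stop_sequence_reverse: "stop_sequence (reverse_global g) = rev (stop_sequence g)"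
  by (simp add: stop_sequence_def reverse_global_def reverse_leg_def rev_concat rev_map o_def)

text \<open>
  The first stop tells which cluster is visited first, and hence how many stops the first leg has;
  two distinct stops then show in which direction it is traversed.
\<close>

lemma legs_along_stop_sequence_inj:
  assumes "legs_along p g" "legs_along q h" "set p \<subseteq> {..<m}" "set q \<subseteq> {..<m}"
    and "stop_sequence g = stop_sequence h" "\<And>i. i < m \<Longrightarrow> length (r i) \<ge> 2"
  shows "g = h"
  using assms(1-5)
proof (induction g arbitrary: p q h rule: list.induct)
  case Nil
  then show ?case
    using leg_not_Nil by (cases h) (auto simp: stop_sequence_def list_all2_Cons2)
next
  case (Cons l g)
  from Cons.prems obtain i p' where
    p: "p = i # p'" "i < m" "l \<in> legs (r i)" "legs_along p' g" "set p' \<subseteq> {..<m}"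
    by (auto simp: list_all2_Cons2)
  have l: "snd l \<noteq> []"
    using p leg_not_Nil by blast
  with Cons.prems obtain l' h' where h: "h = l' # h'"
    by (cases h) (auto simp: stop_sequence_def)
  with Cons.prems obtain j q' where
    q: "q = j # q'" "j < m" "l' \<in> legs (r j)" "legs_along q' h'" "set q' \<subseteq> {..<m}"
    by (auto simp: list_all2_Cons2)
  have l': "snd l' \<noteq> []"
    using q leg_not_Nil by blast
  have eq: "snd l @ stop_sequence g = snd l' @ stop_sequence h'"
    using Cons.prems(5) by (simp add: stop_sequence_def h)
  have "hd (snd l) = hd (snd l')"
    using arg_cong[OF eq, of hd] l l' by simp
  then have "i = j"
    using cluster_eq_if_common_stop p q l l' by (metis hd_in_set)
  then have split: "snd l = snd l'" "stop_sequence g = stop_sequence h'"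
    using eq length_snd_leg[OF p(3)] length_snd_leg[OF q(3)] by auto
  have "rev (r i) \<noteq> r i"
    using distinct_palindrome_length[of "r i"] dist[OF p(2)] assms(6)[OF p(2)] by auto
  then have "l = l'"
    using p(3) q(3) split(1) \<open>i = j\<close> by (auto simp: legs_def)
  with Cons.IH[OF p(4) q(4) p(5) q(5) split(2)] h show ?case
    by simp
qed

lemma stop_sequence_inj:
  assumes "\<And>i. i < m \<Longrightarrow> length (r i) \<ge> 2"
  shows "inj_on stop_sequence (global_routes r m)"
proof (rule inj_onI)
  fix g h
  assume g: "g \<in> global_routes r m" and h: "h \<in> global_routes r m"
    and eq: "stop_sequence g = stop_sequence h"
  from g obtain p where p: "legs_along p g" "set p = {..<m}"
    by (rule global_routesE)
  from h obtain q where q: "legs_along q h" "set q = {..<m}"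
    by (rule global_routesE)
  show "g = h"
    by (rule legs_along_stop_sequence_inj[OF p(1) q(1) _ _ eq assms]) (simp_all add: p q)
qed

lemma set_stop_sequence:
  "legs_along p g \<Longrightarrow> set (stop_sequence g) = (\<Union>i\<in>set p. set (r i))"
  by (induction rule: list_all2_induct) (simp_all add: stop_sequence_def set_snd_leg)

lemma distinct_stop_sequence:
  assumes "legs_along p g" "distinct p" "set p \<subseteq> {..<m}"
  shows "distinct (stop_sequence g)"
  using assms
proof (induction rule: list_all2_induct)
  case (Cons i p l g)
  have "set (snd l) \<inter> set (stop_sequence g) = {}"
    using Cons disj by (fastforce simp: set_stop_sequence set_snd_leg)
  moreover have "distinct (snd l)"
    using Cons dist by (auto simp: legs_def)
  ultimately show ?case
    using Cons by (simp add: stop_sequence_def)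
qed (simp add: stop_sequence_def)

lemma length_stop_sequence:
  assumes "g \<in> global_routes r m" "\<And>i. i < m \<Longrightarrow> length (r i) \<ge> 2"
  shows "length (stop_sequence g) \<ge> 2"
proof -
  from assms(1) obtain p where p: "legs_along p g" "set p = {..<m}" "length p = m"
    by (rule global_routesE)
  with m_pos obtain i p' where i: "p = i # p'"
    by (cases p) auto
  with p obtain l g' where "g = l # g'" "l \<in> legs (r i)"
    by (auto simp: list_all2_Cons1)
  moreover have "i < m"
    using p(2) i by (metis lessThan_iff list.set_intros(1))
  ultimately show ?thesis
    using assms(2)[of i] by (simp add: stop_sequence_def length_snd_leg)
qed

lemma card_undirected_stop_sequences:
  assumes "\<And>i. i < m \<Longrightarrow> length (r i) \<ge> 2"
  shows "card (undirected ` stop_sequence ` global_routes r m) = fact m * 2 ^ (m - 1)"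
proof (rule half_directed)
  have "2 * card (undirected ` stop_sequence ` global_routes r m)
      = card (stop_sequence ` global_routes r m)"
  proof (rule two_card_undirected)
    show "finite (stop_sequence ` global_routes r m)"
      by (simp add: finite_global_routes)
    show "rev ` stop_sequence ` global_routes r m \<subseteq> stop_sequence ` global_routes r m"
      using reverse_global_in by (auto simp flip: stop_sequence_reverse)
    show "distinct xs \<and> length xs \<ge> 2" if "xs \<in> stop_sequence ` global_routes r m" for xs
    proof -
      from that obtain g where g: "g \<in> global_routes r m" "xs = stop_sequence g"
        by blast
      from g(1) obtain p where "legs_along p g" "set p = {..<m}" "distinct p"
        by (rule global_routesE)
      then show ?thesis
        using distinct_stop_sequence length_stop_sequence[OF g(1) assms] g(2) by simp
    qed
  qed
  then show "2 * card (undirected ` stop_sequence ` global_routes r m) = card (global_routes r m)"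
    using card_image[OF stop_sequence_inj[OF assms]] by simp
qed

end

section \<open>The total cost\<close>

theorem mainTheorem1:
  fixes S :: "'a set" and C :: "nat \<Rightarrow> 'a set" and r :: "nat \<Rightarrow> 'a list"
    and n m :: nat and k :: "nat \<Rightarrow> nat"
  assumes "finite S" and "card S = n"
    and "m \<ge> 1"
    and "(\<Union>i<m. C i) = S"
    and "disjoint_family_on C {..<m}"
    and "\<And>i. i < m \<Longrightarrow> C i \<noteq> {}"
    and "\<And>i. i < m \<Longrightarrow> card (C i) = k i"
    and "(\<Sum>i<m. k i) = n"
    and "\<And>i. i < m \<Longrightarrow> r i \<in> permutations_of_set (C i)"
  shows "card (global_undirected_routes r m) = fact m * 2 ^ (m - 1)
    \<and> ((\<forall>i<m. k i \<ge> 2) \<longrightarrow>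
         card (undirected ` stop_sequence ` global_routes r m) = fact m * 2 ^ (m - 1))
    \<and> total_cost C r m = fact m * 2 ^ (m - 1) + 1 / 2 * (\<Sum>i<m. fact (k i))"
proof -
  have r: "set (r i) = C i" "distinct (r i)" if "i < m" for i
    using assms(9)[OF that] by (auto simp: permutations_of_set_def)
  interpret disjoint_routes r m
  proof
    show "set (r i) \<inter> set (r j) = {}" if "i < m" "j < m" "i \<noteq> j" for i j
      using that assms(5) r by (simp add: disjoint_family_on_def)
    show "r i \<noteq> []" if "i < m" for i
      using r(1)[OF that] assms(6)[OF that] by auto
  qed (use r assms(3) in auto)
  have len: "length (r i) = k i" if "i < m" for i
    using that r assms(7) distinct_card by metis
  have cost: "cluster_cost (C i) = fact (k i) / 2" if "i < m" for i
    using r(1)[OF that] assms(7)[OF that] cluster_cost_eq[of "C i"] by (metis List.finite_set)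
  have "total_cost C r m = fact m * 2 ^ (m - 1) + 1 / 2 * (\<Sum>i<m. fact (k i))"
    unfolding total_cost_def by (simp add: card_global_undirected_routes cost sum_divide_distrib)
  moreover have "card (undirected ` stop_sequence ` global_routes r m) = fact m * 2 ^ (m - 1)"
    if "\<forall>i<m. k i \<ge> 2"
    using that len by (intro card_undirected_stop_sequences) simp
  ultimately show ?thesis
    using card_global_undirected_routes by blast
qed

end
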